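(* Let $\mathfrak{g}=A_{5,2}$ and let $\langle\cdot,\cdot\rangle$ be an inner product on $\mathfrak{g}$. Let $\eta>0$ and let $\{v_1,\dots,v_5\}$ be a basis of $\mathfrak{g}$, orthonormal with respect to $\eta\langle\cdot,\cdot\rangle$, whose only nonzero brackets (up to antisymmetry) are $[v_1,v_2]=\alpha v_3+\beta v_4$, $[v_1,v_3]=\gamma v_4$, $[v_1,v_4]=\delta v_5$, with $\alpha,\gamma,\delta>0$ and $\beta\in\mathbb{R}$. Then $\langle\cdot,\cdot\rangle$ is a Schouten like metric if and only if $\beta=0$ and $\alpha=\delta=\frac{\sqrt{3}}{2}\gamma$.
   Context: $A_{5,2}$ is the five-dimensional real nilpotent Lie algebra having a basis with the brackets displayed in the claim. An inner product on $\mathfrak{g}$ is identified with the left-invariant Riemannian metric $g$ it induces on the simply connected Lie group $G$ with Lie algebra $\mathfrak{g}$. Let $ric_g$ be the Ricci curvature tensor of $(G,g)$ (Levi-Civita connection), viewed as a symmetric bilinear form on $\mathfrak{g}$; since $\mathfrak{g}$ is nilpotent, $ric_g(u,v)=-\frac12\mathrm{tr}(ad_u\circ ad_v^* )-\frac14\mathrm{tr}(J_u\circ J_v)$, where $ad_uv=[u,v]$, $ad_v^*$ is the $g$-transpose of $ad_v$, and $J_uv=ad_v^*u$. The Ricci operator $Ric_g$ is defined by $ric_g(u,v)=g(Ric_g(u),v)$ and $s=\mathrm{tr}(Ric_g)$ is the scalar curvature. A derivation $D$ of $\mathfrak{g}$ is symmetric with respect to $g$ if $g(Du,v)=g(u,Dv)$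 for all $u,v$. The metric $g$ is a Schouten like metric if there are real numbers $\lambda_0,c$ and a derivation $D$ of $\mathfrak{g}$, symmetric with respect to $g$, such that $ric_g(X,Y)=(s\lambda_0+c)g(X,Y)+g(D(X),Y)$ for all $X,Y\in\mathfrak{g}$. *)

theory Defs
  imports "HOL-Analysis.Analysis"
begin

section \<open>Finite-dimensional linear algebra\<close>

definition is_basis :: "nat \<Rightarrow> (nat \<Rightarrow> 'g::real_vector) \<Rightarrow> bool" where
  "is_basis n v \<longleftrightarrow> inj_on v {1..n} \<and> independent (v ` {1..n}) \<and> span (v ` {1..n}) = UNIV"

definition inner_product :: "('g::real_vector \<Rightarrow> 'g \<Rightarrow> real) \<Rightarrow> bool" where
  "inner_product g \<longleftrightarrow>
     bilinear g \<and> (\<forall>u v. g u v = g v u) \<and> (\<forall>u. u \<noteq> 0 \<longrightarrow> g u u > 0)"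

text \<open>
  The trace of an endomorphism, computed in some basis.  By the lemma \<open>lin_trace_eq\<close> below,
  the choice of basis is immaterial in finite dimension.
\<close>

definition lin_trace :: "('g::real_vector \<Rightarrow> 'g) \<Rightarrow> real" where
  "lin_trace f =
     (let B = (SOME B. independent B \<and> span B = UNIV) in \<Sum>b\<in>B. representation B (f b) b)"

lemma representation_sum_basis_trace:
  fixes f :: "'g::real_vector \<Rightarrow> 'g"
  assumes f: "linear f" and B: "independent B" "span B = UNIV" "finite B"
    and C: "independent C" "span C = UNIV" "finite C"
  shows "(\<Sum>b\<in>B. representation B (f b) b) = (\<Sum>c\<in>C. representation C (f c) c)"
proof -
  have exp: "(\<Sum>b\<in>A. representation A x b *\<^sub>R b) = x"
    if "independent A" "span A = UNIV" "finite A" for A and x :: 'g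
    using real_vector.sum_representation_eq[OF that(1), of x A] that by auto
  have lin: "linear (\<lambda>x. representation A x b)" if "independent A" "span A = UNIV" for A and b :: 'g
    using that by (intro linearI) (simp_all add: real_vector.representation_add real_vector.representation_scale)
  have "(\<Sum>b\<in>B. representation B (f b) b)
      = (\<Sum>b\<in>B. representation B (\<Sum>c\<in>C. representation C (f b) c *\<^sub>R c) b)"
    by (simp add: exp[OF C])
  also have "\<dots> = (\<Sum>b\<in>B. \<Sum>c\<in>C. representation C (f b) c * representation B c b)"
    by (simp add: linear_sum[OF lin[OF B(1,2)]] linear_cmul[OF lin[OF B(1,2)]])
  also have "\<dots> = (\<Sum>c\<in>C. \<Sum>b\<in>B. representation C (f b) c * representation B c b)"
    by (rule sum.swap)
  also have "\<dots> = (\<Sum>c\<in>C. representation C (f (\<Sum>b\<in>B. representation B c b *\<^sub>R b)) c)"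
    by (simp add: linear_sum[OF lin[OF C(1,2)]] linear_cmul[OF lin[OF C(1,2)]]
        linear_sum[OF f] linear_cmul[OF f] mult.commute)
  also have "\<dots> = (\<Sum>c\<in>C. representation C (f c) c)"
    by (simp add: exp[OF B])
  finally show ?thesis .
qed

lemma lin_trace_eq:
  fixes f :: "'g::real_vector \<Rightarrow> 'g"
  assumes "linear f" "independent B" "span B = UNIV" "finite B"
  shows "lin_trace f = (\<Sum>b\<in>B. representation B (f b) b)"
proof -
  define C :: "'g set" where "C = (SOME B. independent B \<and> span B = UNIV)"
  have C: "independent C \<and> span C = UNIV"
    unfolding C_def by (rule someI[of _ B]) (use assms in auto)
  have "finite C"
    using real_vector.independent_span_bound[OF \<open>finite B\<close>, of C] C assms by auto
  then show ?thesis
    unfolding lin_trace_def Let_def C_def[symmetric]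
    using representation_sum_basis_trace[OF assms(1)] assms C by metis
qed

section \<open>Lie algebras\<close>

definition lie_algebra :: "('g::real_vector \<Rightarrow> 'g \<Rightarrow> 'g) \<Rightarrow> bool" where
  "lie_algebra br \<longleftrightarrow>
     bilinear br \<and> (\<forall>u. br u u = 0) \<and>
     (\<forall>u v w. br u (br v w) + br v (br w u) + br w (br u v) = 0)"

definition derivation :: "('g::real_vector \<Rightarrow> 'g \<Rightarrow> 'g) \<Rightarrow> ('g \<Rightarrow> 'g) \<Rightarrow> bool" where
  "derivation br D \<longleftrightarrow> linear D \<and> (\<forall>u v. D (br u v) = br (D u) v + br u (D v))"

definition A52_brackets ::
  "('g::real_vector \<Rightarrow> 'g \<Rightarrow> 'g) \<Rightarrow> (nat \<Rightarrow> 'g) \<Rightarrow> real \<Rightarrow> real \<Rightarrow> real \<Rightarrow> real \<Rightarrow> bool" where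
  "A52_brackets br v \<alpha> \<beta> \<gamma> \<delta> \<longleftrightarrow>
     (\<forall>i\<in>{1..5}. \<forall>j\<in>{1..5}. i < j \<longrightarrow>
        br (v i) (v j) =
          (if (i, j) = (1, 2) then \<alpha> *\<^sub>R v 3 + \<beta> *\<^sub>R v 4
           else if (i, j) = (1, 3) then \<gamma> *\<^sub>R v 4
           else if (i, j) = (1, 4) then \<delta> *\<^sub>R v 5
           else 0))"

text \<open>
  The isomorphism class, fixed by the normalized table
  \<open>[e1,e2] = e3, [e1,e3] = e4, [e1,e4] = e5\<close>.  A basis \<open>v\<close> with
  \<open>A52_brackets br v \<alpha> \<beta> \<gamma> \<delta>\<close> and \<open>\<alpha>, \<gamma>, \<delta>\<close> nonzero gives a normalized one:
  \<open>v1, v2, \<alpha> v3 + \<beta> v4, \<alpha> \<gamma> v4 + \<beta> \<delta> v5, \<alpha> \<gamma> \<delta> v5\<close>.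
\<close>

definition is_A52 :: "('g::real_vector \<Rightarrow> 'g \<Rightarrow> 'g) \<Rightarrow> bool" where
  "is_A52 br \<longleftrightarrow> lie_algebra br \<and> (\<exists>e. is_basis 5 e \<and> A52_brackets br e 1 0 1 1)"

section \<open>Curvature of a left-invariant metric\<close>

text \<open>
  For a left-invariant metric the covariant derivative of left-invariant vector fields along
  left-invariant vector fields is left-invariant.  Identifying such fields with elements of the
  Lie algebra, the Levi-Civita connection is a bilinear product \<open>n u v\<close> (the covariant derivative
  of \<open>v\<close> along \<open>u\<close>).  It is torsion-free, and since the functions \<open>g v w\<close> are constant,
  compatibility with the metric says that \<open>n u\<close> is skew-symmetric.
\<close>

definition is_levi_civita ::
  "('g::real_vector \<Rightarrow> 'g \<Rightarrow> 'g) \<Rightarrow> ('g \<Rightarrow> 'g \<Rightarrow> real) \<Rightarrow> ('g \<Rightarrow> 'g \<Rightarrow> 'g) \<Rightarrow> bool" where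
  "is_levi_civita br g n \<longleftrightarrow>
     bilinear n \<and>
     (\<forall>u v. n u v - n v u = br u v) \<and>
     (\<forall>u v w. g (n u v) w + g v (n u w) = 0)"

definition levi_civita ::
  "('g::real_vector \<Rightarrow> 'g \<Rightarrow> 'g) \<Rightarrow> ('g \<Rightarrow> 'g \<Rightarrow> real) \<Rightarrow> 'g \<Rightarrow> 'g \<Rightarrow> 'g" where
  "levi_civita br g = (THE n. is_levi_civita br g n)"

definition curvature ::
  "('g::real_vector \<Rightarrow> 'g \<Rightarrow> 'g) \<Rightarrow> ('g \<Rightarrow> 'g \<Rightarrow> real) \<Rightarrow> 'g \<Rightarrow> 'g \<Rightarrow> 'g \<Rightarrow> 'g" where
  "curvature br g u v w =
     (let n = levi_civita br g in n u (n v w) - n v (n u w) - n (br u v) w)"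

definition ricci ::
  "('g::real_vector \<Rightarrow> 'g \<Rightarrow> 'g) \<Rightarrow> ('g \<Rightarrow> 'g \<Rightarrow> real) \<Rightarrow> 'g \<Rightarrow> 'g \<Rightarrow> real" where
  "ricci br g u v = lin_trace (\<lambda>w. curvature br g w u v)"

definition ricci_operator ::
  "('g::real_vector \<Rightarrow> 'g \<Rightarrow> 'g) \<Rightarrow> ('g \<Rightarrow> 'g \<Rightarrow> real) \<Rightarrow> 'g \<Rightarrow> 'g" where
  "ricci_operator br g = (THE F. linear F \<and> (\<forall>u v. ricci br g u v = g (F u) v))"

definition scalar_curvature ::
  "('g::real_vector \<Rightarrow> 'g \<Rightarrow> 'g) \<Rightarrow> ('g \<Rightarrow> 'g \<Rightarrow> real) \<Rightarrow> real" where
  "scalar_curvature br g = lin_trace (ricci_operator br g)"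

lemma is_levi_civita_koszul:
  assumes g: "inner_product g" and n: "is_levi_civita br g n"
  shows "2 * g (n u v) w = g (br u v) w - g (br v w) u + g (br w u) v"
proof -
  have bl: "bilinear g" and sym: "\<And>x y. g x y = g y x"
    using g by (auto simp: inner_product_def)
  have tor: "br x y = n x y - n y x" and skew: "g (n x y) z = - g (n x z) y" for x y z
    using n sym[of y "n x z"] unfolding is_levi_civita_def by (simp, smt (verit))
  have "g (br x y) z = g (n x y) z - g (n y x) z" for x y z
    unfolding tor by (simp add: bilinear_lsub[OF bl])
  then show ?thesis
    using skew[of u v w] skew[of v w u] skew[of w u v] by simp
qed

lemma is_levi_civita_unique:
  assumes g: "inner_product g" and n: "is_levi_civita br g n" and m: "is_levi_civita br g m"
  shows "n = m"
proof (intro ext)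
  fix u v
  have "g (n u v) w = g (m u v) w" for w
    using is_levi_civita_koszul[OF g n, of u v w] is_levi_civita_koszul[OF g m, of u v w] by simp
  then have "g (n u v - m u v) (n u v - m u v) = 0"
    using g bilinear_lsub[of g] by (simp add: inner_product_def)
  then show "n u v = m u v"
    using g unfolding inner_product_def by (metis less_irrefl eq_iff_diff_eq_0)
qed

lemma levi_civita_eq:
  assumes "inner_product g" "is_levi_civita br g n"
  shows "levi_civita br g = n"
  unfolding levi_civita_def using assms is_levi_civita_unique by blast

lemma is_levi_civita_exists:
  fixes br :: "'g::real_vector \<Rightarrow> 'g \<Rightarrow> 'g"
  assumes g: "inner_product g" and br: "lie_algebra br"
    and E: "finite E" "span E = UNIV"
      "\<And>e f. e \<in> E \<Longrightarrow> f \<in> E \<Longrightarrow> g e f = (if e = f then 1 else 0)"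
  shows "is_levi_civita br g (levi_civita br g)"
proof -
  have bg: "bilinear g" and sym: "\<And>x y. g x y = g y x"
    using g unfolding inner_product_def by blast+
  have pos: "x = 0" if "g x x = 0" for x
    using g that unfolding inner_product_def by (metis less_irrefl)
  have bb: "bilinear br" and alt: "\<And>x. br x x = 0"
    using br by (auto simp: lie_algebra_def)
  note G = bilinear_ladd[OF bg] bilinear_radd[OF bg] bilinear_lmul[OF bg] bilinear_rmul[OF bg]
    bilinear_lsub[OF bg] bilinear_rsub[OF bg] bilinear_lneg[OF bg] bilinear_rneg[OF bg]
  note B = bilinear_ladd[OF bb] bilinear_radd[OF bb] bilinear_lmul[OF bb] bilinear_rmul[OF bb]
  have anti: "br x y = - br y x" for x y
  proof -
    have "br x y + br y x = (br x x + br x y) + (br y x + br y y)"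
      by (simp add: alt)
    also have "\<dots> = br x (x + y) + br y (x + y)"
      by (simp only: bilinear_radd[OF bb])
    also have "\<dots> = br (x + y) (x + y)"
      by (simp only: bilinear_ladd[OF bb])
    finally show ?thesis
      by (simp only: alt eq_neg_iff_add_eq_0)
  qed
  define K where "K u v w = (g (br u v) w - g (br v w) u + g (br w u) v) / 2" for u v w
  define n where "n u v = (\<Sum>e\<in>E. K u v e *\<^sub>R e)" for u v
  have lin_g: "linear (g x)" for x
    using bg by (simp add: bilinear_def)
  have lin_K: "linear (K u v)" for u v
    by (intro linearI) (simp_all add: K_def G B field_simps)
  have key: "g (n u v) w = K u v w" for u v w
  proof (rule linear_eq_on_span[OF lin_g lin_K, of E])
    fix f assume f: "f \<in> E"
    have "g (n u v) f = g f (n u v)" by (rule sym)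
    also have "\<dots> = (\<Sum>e\<in>E. K u v e * g f e)"
      by (simp add: n_def linear_sum[OF lin_g] linear_cmul[OF lin_g])
    also have "\<dots> = (\<Sum>e\<in>E. if e = f then K u v f else 0)"
      by (intro sum.cong) (auto simp: E(3) f)
    also have "\<dots> = K u v f"
      using f E(1) by simp
    finally show "g (n u v) f = K u v f" .
  qed (use E in auto)
  have ext: "x = y" if "\<And>w. g x w = g y w" for x y
    using pos[of "x - y"] that by (simp add: G)
  have "bilinear n"
    unfolding bilinear_def
    by (intro conjI allI linearI; rule ext) (simp_all add: key G K_def B field_simps)
  moreover have "n u v - n v u = br u v" for u v
  proof (rule ext)
    fix w show "g (n u v - n v u) w = g (br u v) w"
      using anti[of v u] anti[of w u] anti[of w v] by (simp add: key G K_def field_simps)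
  qed
  moreover have "g (n u v) w + g v (n u w) = 0" for u v w
    using anti[of v u] anti[of w u] anti[of w v] sym[of v "n u w"] by (simp add: key G K_def field_simps)
  ultimately have "is_levi_civita br g n"
    by (auto simp: is_levi_civita_def)
  then show ?thesis
    using levi_civita_eq[OF g] by simp
qed

definition schouten_like ::
  "('g::real_vector \<Rightarrow> 'g \<Rightarrow> 'g) \<Rightarrow> ('g \<Rightarrow> 'g \<Rightarrow> real) \<Rightarrow> bool" where
  "schouten_like br g \<longleftrightarrow>
     (\<exists>l0 c D. derivation br D \<and> (\<forall>u v. g (D u) v = g u (D v)) \<and>
        (\<forall>X Y. ricci br g X Y = (scalar_curvature br g * l0 + c) * g X Y + g (D X) Y))"

end

theory Submission
  imports Defs
begin

text \<open>
  The Levi-Civita connection and the Ricci form do not change when the metric is rescaled, so we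
  may assume that the frame \<open>v\<close> is orthonormal for the metric itself.  The Ricci form is then
  tridiagonal in the frame, and \<open>D = Ric - c\<close> is determined by it.  The \<open>v 4\<close>-component of
  the derivation identity on \<open>[v 1, v 4]\<close> reads \<open>\<alpha> \<beta> \<gamma> = 0\<close>, so \<open>\<beta> = 0\<close> and \<open>D\<close> is
  diagonal.  Its eigenvalues must satisfy \<open>d3 = d1 + d2\<close>, \<open>d4 = d1 + d3\<close>, \<open>d5 = d1 + d4\<close>;
  eliminating \<open>c\<close> gives \<open>2 \<alpha>\<^sup>2 - \<gamma>\<^sup>2 = 2 \<gamma>\<^sup>2 - \<alpha>\<^sup>2 - \<delta>\<^sup>2 = 2 \<delta>\<^sup>2 - \<gamma>\<^sup>2\<close>.
\<close>

text \<open>Keeps the index of \<open>v 1\<close> a numeral.\<close>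

declare One_nat_def [simp del]

section \<open>Coordinates and traces in an orthonormal basis\<close>

lemma orthonormal_expansion:
  fixes g :: "'g::real_vector \<Rightarrow> 'g \<Rightarrow> real"
  assumes "is_basis n v" "bilinear g"
    and orth: "\<And>i j. i \<in> {1..n} \<Longrightarrow> j \<in> {1..n} \<Longrightarrow> g (v i) (v j) = (if i = j then 1 else 0)"
  shows "(\<Sum>i\<in>{1..n}. g x (v i) *\<^sub>R v i) = x"
proof -
  have sp: "span (v ` {1..n}) = UNIV"
    using assms(1) by (simp add: is_basis_def)
  have lin: "linear (\<lambda>x. \<Sum>i\<in>{1..n}. g x (v i) *\<^sub>R v i)"
    by (intro linearI) (simp_all add: bilinear_ladd[OF assms(2)] bilinear_lmul[OF assms(2)]
        scaleR_add_left sum.distrib scaleR_right.sum)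
  show ?thesis
  proof (rule linear_eq_on_span[OF lin linear_ident, of "v ` {1..n}"])
    fix y assume "y \<in> v ` {1..n}"
    then obtain j where j: "j \<in> {1..n}" "y = v j" by blast
    have "(\<Sum>i\<in>{1..n}. g y (v i) *\<^sub>R v i) = (\<Sum>i\<in>{1..n}. if j = i then v i else 0)"
      using j by (intro sum.cong) (auto simp: orth)
    then show "(\<Sum>i\<in>{1..n}. g y (v i) *\<^sub>R v i) = y"
      using j by simp
  qed (use sp in simp)
qed

text \<open>The coordinate functional of \<open>v j\<close> and the map \<open>g _ (v j)\<close> are
  linear and agree on the basis, so the diagonal entries of \<open>f\<close> are inner
  products.\<close>

lemma lin_trace_orthonormal:
  fixes g :: "'g::real_vector \<Rightarrow> 'g \<Rightarrow> real"
  assumes basis: "is_basis n v" and g: "bilinear g"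
    and orth: "\<And>i j. i \<in> {1..n} \<Longrightarrow> j \<in> {1..n} \<Longrightarrow> g (v i) (v j) = (if i = j then 1 else 0)"
    and f: "linear f"
  shows "lin_trace f = (\<Sum>i\<in>{1..n}. g (f (v i)) (v i))"
proof -
  let ?B = "v ` {1..n}"
  have inj: "inj_on v {1..n}" and ind: "independent ?B" and sp: "span ?B = UNIV"
    using basis by (auto simp: is_basis_def)
  have rep: "representation ?B x (v j) = g x (v j)" if j: "j \<in> {1..n}" for x j
  proof -
    have lin: "linear (\<lambda>x. representation ?B x (v j))"
      using ind sp by (intro linearI)
        (simp_all add: real_vector.representation_add real_vector.representation_scale)
    have lin': "linear (\<lambda>x. g x (v j))"
      using g by (simp add: bilinear_def)
    show ?thesis
    proof (rule linear_eq_on_span[OF lin lin', of ?B])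
      fix y assume "y \<in> ?B"
      then obtain i where i: "i \<in> {1..n}" "y = v i" by blast
      then show "representation ?B y (v j) = g y (v j)"
        using real_vector.representation_basis[OF ind, of y] j inj orth
        by (auto simp: inj_on_eq_iff)
    qed (use sp in simp)
  qed
  have "lin_trace f = (\<Sum>b\<in>?B. representation ?B (f b) b)"
    using lin_trace_eq[OF f ind sp] by simp
  also have "\<dots> = (\<Sum>i\<in>{1..n}. g (f (v i)) (v i))"
    by (simp add: sum.reindex[OF inj] rep)
  finally show ?thesis .
qed

section \<open>Rescaling the metric\<close>

lemma bilinear_scale:
  fixes g :: "'g::real_vector \<Rightarrow> 'g \<Rightarrow> real"
  assumes "bilinear g"
  shows "bilinear (\<lambda>x y. a * g x y)"
  unfolding bilinear_def
  by (intro conjI allI linearI)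
    (simp_all add: bilinear_ladd[OF assms] bilinear_radd[OF assms]
      bilinear_lmul[OF assms] bilinear_rmul[OF assms] distrib_left)

text \<open>Torsion-freeness does not mention the metric and compatibility is homogeneous in it.
  Both metrics thus give the same predicate under \<open>THE\<close>, so neither existence nor
  uniqueness of the connection enters.\<close>

lemma levi_civita_scale:
  assumes "\<eta> \<noteq> 0"
  shows "levi_civita br (\<lambda>x y. \<eta> * g x y) = levi_civita br g"
proof -
  have "\<eta> * a + \<eta> * b = 0 \<longleftrightarrow> a + b = 0" for a b :: real
    using assms by (metis distrib_left mult_eq_0_iff)
  then show ?thesis
    by (simp add: levi_civita_def is_levi_civita_def)
qed

text \<open>The metric enters the curvature only through the connection, and the trace is
  metric-free.\<close>

lemma ricci_scale:
  assumes "\<eta> \<noteq> 0"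
  shows "ricci br (\<lambda>x y. \<eta> * g x y) = ricci br g"
  by (intro ext) (simp add: ricci_def curvature_def levi_civita_scale[OF assms])

text \<open>The scalar curvature plays no role, since the constant \<open>c\<close> is free.\<close>

lemma schouten_like_iff:
  "schouten_like br g \<longleftrightarrow>
     (\<exists>c D. derivation br D \<and> (\<forall>u v. g (D u) v = g u (D v)) \<and>
        (\<forall>X Y. ricci br g X Y = c * g X Y + g (D X) Y))" (is "_ \<longleftrightarrow> ?R")
proof
  assume ?R
  then obtain c D where "derivation br D" "\<forall>u v. g (D u) v = g u (D v)"
    "\<forall>X Y. ricci br g X Y = c * g X Y + g (D X) Y"
    by blast
  moreover have "c = scalar_curvature br g * 0 + c"
    by simp
  ultimately show "schouten_like br g"
    unfolding schouten_like_def by metis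
qed (unfold schouten_like_def, blast)

lemma derivation_scale:
  assumes "derivation br D" "bilinear br"
  shows "derivation br (\<lambda>x. a *\<^sub>R D x)"
  using assms
  by (auto simp: derivation_def linear_compose_scale_right scaleR_add_right
      bilinear_lmul bilinear_rmul)

lemma schouten_like_scale_imp:
  assumes "\<eta> \<noteq> 0" and br: "bilinear br" and g: "bilinear g" and "schouten_like br g"
  shows "schouten_like br (\<lambda>x y. \<eta> * g x y)"
proof -
  obtain c D where D: "derivation br D" "\<forall>u v. g (D u) v = g u (D v)"
    and ric: "\<forall>X Y. ricci br g X Y = c * g X Y + g (D X) Y"
    using assms(4) unfolding schouten_like_iff by blast
  \<comment> \<open>The Ricci form stays fixed while the metric gains the factor \<eta>, so both
    \<open>c\<close> and \<open>D\<close> are divided by \<eta>.\<close>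
  have "derivation br (\<lambda>x. (1 / \<eta>) *\<^sub>R D x)"
    using D br by (intro derivation_scale)
  then show ?thesis
    unfolding schouten_like_iff ricci_scale[OF \<open>\<eta> \<noteq> 0\<close>]
    using D ric \<open>\<eta> \<noteq> 0\<close>
    by (intro exI[of _ "c / \<eta>"] exI[of _ "\<lambda>x. (1 / \<eta>) *\<^sub>R D x"])
      (simp add: bilinear_lmul[OF g] bilinear_rmul[OF g])
qed

lemma schouten_like_scale:
  assumes "\<eta> \<noteq> 0" "bilinear br" and g: "bilinear g"
  shows "schouten_like br (\<lambda>x y. \<eta> * g x y) \<longleftrightarrow> schouten_like br g"
proof
  assume *: "schouten_like br (\<lambda>x y. \<eta> * g x y)"
  \<comment> \<open>Scaling the rescaled metric by \<open>1 / \<eta>\<close> returns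
    \<open>g\<close>.\<close>
  from schouten_like_scale_imp[OF _ assms(2) bilinear_scale[OF g] *, of "1 / \<eta>"]
  show "schouten_like br g"
    using \<open>\<eta> \<noteq> 0\<close> by simp
qed (use assms schouten_like_scale_imp in blast)

section \<open>The orthonormal frame\<close>

lemma sum_5:
  fixes f :: "nat \<Rightarrow> 'b::comm_monoid_add"
  shows "(\<Sum>i\<in>{1..5::nat}. f i) = f 1 + f 2 + f 3 + f 4 + f 5"
  by (simp add: numeral_eq_Suc One_nat_def add.assoc)

lemma frame_index_cases:
  assumes "i \<in> {1..5::nat}"
  obtains "i = 1" | "i = 2" | "i = 3" | "i = 4" | "i = 5"
  using assms by fastforce

text \<open>Here \<open>g\<close> stands for the rescaled metric, for which the frame is orthonormal
  without a factor.\<close>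

locale A52_frame =
  fixes br :: "'g::real_vector \<Rightarrow> 'g \<Rightarrow> 'g"
    and g :: "'g \<Rightarrow> 'g \<Rightarrow> real"
    and v :: "nat \<Rightarrow> 'g"
    and \<alpha> \<beta> \<gamma> \<delta> :: real
  assumes lie: "lie_algebra br"
    and inner: "inner_product g"
    and basis: "is_basis 5 v"
    and orth: "\<And>i j. i \<in> {1..5} \<Longrightarrow> j \<in> {1..5} \<Longrightarrow> g (v i) (v j) = (if i = j then 1 else 0)"
    and brackets: "A52_brackets br v \<alpha> \<beta> \<gamma> \<delta>"
begin

lemma bilinear_g: "bilinear g" and bilinear_br: "bilinear br"
  using inner lie by (auto simp: inner_product_def lie_algebra_def)

lemma g_sym: "g x y = g y x"
  using inner by (auto simp: inner_product_def)

lemmas g_simps = bilinear_ladd[OF bilinear_g] bilinear_radd[OF bilinear_g]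
  bilinear_lmul[OF bilinear_g] bilinear_rmul[OF bilinear_g]
  bilinear_lsub[OF bilinear_g] bilinear_rsub[OF bilinear_g]
  bilinear_lneg[OF bilinear_g] bilinear_rneg[OF bilinear_g]
  bilinear_lzero[OF bilinear_g] bilinear_rzero[OF bilinear_g]

lemmas br_simps = bilinear_ladd[OF bilinear_br] bilinear_radd[OF bilinear_br]
  bilinear_lmul[OF bilinear_br] bilinear_rmul[OF bilinear_br]
  bilinear_lzero[OF bilinear_br] bilinear_rzero[OF bilinear_br]

lemma br_self: "br x x = 0"
  using lie by (simp add: lie_algebra_def)

lemma br_anti: "br x y = - br y x"
proof -
  have "br (x + y) (x + y) = br x y + br y x"
    by (simp only: br_simps(1,2) br_self[of x] br_self[of y]) simp
  then show ?thesis
    by (metis br_self eq_neg_iff_add_eq_0)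
qed

lemma g_frame:
  "g (v 1) (v 1) = 1" "g (v 1) (v 2) = 0" "g (v 1) (v 3) = 0" "g (v 1) (v 4) = 0" "g (v 1) (v 5) = 0"
  "g (v 2) (v 1) = 0" "g (v 2) (v 2) = 1" "g (v 2) (v 3) = 0" "g (v 2) (v 4) = 0" "g (v 2) (v 5) = 0"
  "g (v 3) (v 1) = 0" "g (v 3) (v 2) = 0" "g (v 3) (v 3) = 1" "g (v 3) (v 4) = 0" "g (v 3) (v 5) = 0"
  "g (v 4) (v 1) = 0" "g (v 4) (v 2) = 0" "g (v 4) (v 3) = 0" "g (v 4) (v 4) = 1" "g (v 4) (v 5) = 0"
  "g (v 5) (v 1) = 0" "g (v 5) (v 2) = 0" "g (v 5) (v 3) = 0" "g (v 5) (v 4) = 0" "g (v 5) (v 5) = 1"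
  by (simp_all add: orth)

lemma br_frame_lt:
  "br (v 1) (v 2) = \<alpha> *\<^sub>R v 3 + \<beta> *\<^sub>R v 4" "br (v 1) (v 3) = \<gamma> *\<^sub>R v 4"
  "br (v 1) (v 4) = \<delta> *\<^sub>R v 5" "br (v 1) (v 5) = 0"
  "br (v 2) (v 3) = 0" "br (v 2) (v 4) = 0" "br (v 2) (v 5) = 0"
  "br (v 3) (v 4) = 0" "br (v 3) (v 5) = 0" "br (v 4) (v 5) = 0"
  using brackets unfolding A52_brackets_def by simp_all

lemma br_frame_gt:
  "br (v 2) (v 1) = - (\<alpha> *\<^sub>R v 3 + \<beta> *\<^sub>R v 4)" "br (v 3) (v 1) = - (\<gamma> *\<^sub>R v 4)"
  "br (v 4) (v 1) = - (\<delta> *\<^sub>R v 5)" "br (v 5) (v 1) = 0"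
  "br (v 3) (v 2) = 0" "br (v 4) (v 2) = 0" "br (v 5) (v 2) = 0"
  "br (v 4) (v 3) = 0" "br (v 5) (v 3) = 0" "br (v 5) (v 4) = 0"
  by (subst br_anti, simp add: br_frame_lt)+

lemmas frame_simps = g_simps br_simps br_self g_frame br_frame_lt br_frame_gt

lemma expansion:
  "g x (v 1) *\<^sub>R v 1 + g x (v 2) *\<^sub>R v 2 + g x (v 3) *\<^sub>R v 3 + g x (v 4) *\<^sub>R v 4 + g x (v 5) *\<^sub>R v 5 = x"
  using orthonormal_expansion[OF basis bilinear_g orth, of x] by (simp add: sum_5)

text \<open>Reduces a vector identity to five scalar ones, the form in which the Koszul formula and
  the Ricci form supply their data.\<close>

lemma frame_eqI:
  assumes "g x (v 1) = g y (v 1)" "g x (v 2) = g y (v 2)" "g x (v 3) = g y (v 3)"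
    "g x (v 4) = g y (v 4)" "g x (v 5) = g y (v 5)"
  shows "x = y"
  by (rule trans[OF expansion[symmetric]]) (simp only: assms expansion)

section \<open>Connection and Ricci form in the frame\<close>

abbreviation nabla :: "'g \<Rightarrow> 'g \<Rightarrow> 'g" where
  "nabla \<equiv> levi_civita br g"

text \<open>The frame is the finite orthonormal spanning set that existence asks for, so
  \<open>nabla\<close> really has the defining properties.\<close>

lemma levi_civita: "is_levi_civita br g nabla"
proof (rule is_levi_civita_exists[OF inner lie, of "v ` {1..5}"])
  show "g e f = (if e = f then 1 else 0)" if "e \<in> v ` {1..5}" "f \<in> v ` {1..5}" for e f
    using that basis orth by (auto simp: is_basis_def inj_on_eq_iff)
qed (use basis in \<open>auto simp: is_basis_def\<close>)

lemma bilinear_nabla: "bilinear nabla"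
  using levi_civita by (simp add: is_levi_civita_def)

lemmas nabla_simps = bilinear_ladd[OF bilinear_nabla] bilinear_radd[OF bilinear_nabla]
  bilinear_lmul[OF bilinear_nabla] bilinear_rmul[OF bilinear_nabla]
  bilinear_lsub[OF bilinear_nabla] bilinear_rsub[OF bilinear_nabla]
  bilinear_lneg[OF bilinear_nabla] bilinear_rneg[OF bilinear_nabla]
  bilinear_lzero[OF bilinear_nabla] bilinear_rzero[OF bilinear_nabla]

text \<open>Determines the connection from the bracket table alone, one frame component at a
  time.\<close>

lemma koszul: "g (nabla x y) z = (g (br x y) z - g (br y z) x + g (br z x) y) / 2"
  using is_levi_civita_koszul[OF inner levi_civita, of x y z] by simp

lemma nabla_frame:
  "nabla (v 1) (v 1) = 0"
  "nabla (v 1) (v 2) = (\<alpha> / 2) *\<^sub>R v 3 + (\<beta> / 2) *\<^sub>R v 4"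
  "nabla (v 1) (v 3) = - (\<alpha> / 2) *\<^sub>R v 2 + (\<gamma> / 2) *\<^sub>R v 4"
  "nabla (v 1) (v 4) = - (\<beta> / 2) *\<^sub>R v 2 - (\<gamma> / 2) *\<^sub>R v 3 + (\<delta> / 2) *\<^sub>R v 5"
  "nabla (v 1) (v 5) = - (\<delta> / 2) *\<^sub>R v 4"
  "nabla (v 2) (v 1) = - (\<alpha> / 2) *\<^sub>R v 3 - (\<beta> / 2) *\<^sub>R v 4"
  "nabla (v 2) (v 2) = 0"
  "nabla (v 2) (v 3) = (\<alpha> / 2) *\<^sub>R v 1"
  "nabla (v 2) (v 4) = (\<beta> / 2) *\<^sub>R v 1"
  "nabla (v 2) (v 5) = 0"
  "nabla (v 3) (v 1) = - (\<alpha> / 2) *\<^sub>R v 2 - (\<gamma> / 2) *\<^sub>R v 4"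
  "nabla (v 3) (v 2) = (\<alpha> / 2) *\<^sub>R v 1"
  "nabla (v 3) (v 3) = 0"
  "nabla (v 3) (v 4) = (\<gamma> / 2) *\<^sub>R v 1"
  "nabla (v 3) (v 5) = 0"
  "nabla (v 4) (v 1) = - (\<beta> / 2) *\<^sub>R v 2 - (\<gamma> / 2) *\<^sub>R v 3 - (\<delta> / 2) *\<^sub>R v 5"
  "nabla (v 4) (v 2) = (\<beta> / 2) *\<^sub>R v 1"
  "nabla (v 4) (v 3) = (\<gamma> / 2) *\<^sub>R v 1"
  "nabla (v 4) (v 4) = 0"
  "nabla (v 4) (v 5) = (\<delta> / 2) *\<^sub>R v 1"
  "nabla (v 5) (v 1) = - (\<delta> / 2) *\<^sub>R v 4"
  "nabla (v 5) (v 2) = 0"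
  "nabla (v 5) (v 3) = 0"
  "nabla (v 5) (v 4) = (\<delta> / 2) *\<^sub>R v 1"
  "nabla (v 5) (v 5) = 0"
  by (rule frame_eqI; simp add: koszul frame_simps)+

lemma ricci_eq_sum: "ricci br g x y = (\<Sum>i\<in>{1..5}. g (curvature br g (v i) x y) (v i))"
  unfolding ricci_def
proof (rule lin_trace_orthonormal[OF basis bilinear_g orth])
  show "linear (\<lambda>w. curvature br g w x y)"
    by (intro linearI) (simp_all add: curvature_def Let_def nabla_simps br_simps algebra_simps)
qed

lemma bilinear_ricci: "bilinear (ricci br g)"
  unfolding bilinear_def
  by (intro conjI allI linearI)
    (simp_all add: ricci_eq_sum sum_5 curvature_def Let_def nabla_simps br_simps g_simps algebra_simps)

text \<open>The only nonzero off-diagonal entries sit at the index pairs (2,3) and (3,4), and both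
  carry the factor \<beta>. Hence the form is diagonal once \<beta> vanishes.\<close>

lemma ricci_frame:
  "ricci br g (v 1) (v 1) = - (\<alpha>\<^sup>2 + \<beta>\<^sup>2 + \<gamma>\<^sup>2 + \<delta>\<^sup>2) / 2"
  "ricci br g (v 2) (v 2) = - (\<alpha>\<^sup>2 + \<beta>\<^sup>2) / 2"
  "ricci br g (v 3) (v 3) = (\<alpha>\<^sup>2 - \<gamma>\<^sup>2) / 2"
  "ricci br g (v 4) (v 4) = (\<beta>\<^sup>2 + \<gamma>\<^sup>2 - \<delta>\<^sup>2) / 2"
  "ricci br g (v 5) (v 5) = \<delta>\<^sup>2 / 2"
  "ricci br g (v 2) (v 3) = - (\<beta> * \<gamma>) / 2" "ricci br g (v 3) (v 2) = - (\<beta> * \<gamma>) / 2"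
  "ricci br g (v 3) (v 4) = \<alpha> * \<beta> / 2" "ricci br g (v 4) (v 3) = \<alpha> * \<beta> / 2"
  "ricci br g (v 1) (v 2) = 0" "ricci br g (v 2) (v 1) = 0"
  "ricci br g (v 1) (v 3) = 0" "ricci br g (v 3) (v 1) = 0"
  "ricci br g (v 1) (v 4) = 0" "ricci br g (v 4) (v 1) = 0"
  "ricci br g (v 1) (v 5) = 0" "ricci br g (v 5) (v 1) = 0"
  "ricci br g (v 2) (v 4) = 0" "ricci br g (v 4) (v 2) = 0"
  "ricci br g (v 2) (v 5) = 0" "ricci br g (v 5) (v 2) = 0"
  "ricci br g (v 3) (v 5) = 0" "ricci br g (v 5) (v 3) = 0"
  "ricci br g (v 4) (v 5) = 0" "ricci br g (v 5) (v 4) = 0"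
  by (simp_all add: ricci_eq_sum sum_5 curvature_def Let_def nabla_simps frame_simps nabla_frame
      power2_eq_square field_simps)

section \<open>The derivation condition\<close>

lemma bilinear_eq_on_frame:
  assumes f: "bilinear f" and h: "bilinear h"
    and "\<And>i j. i \<in> {1..5} \<Longrightarrow> j \<in> {1..5} \<Longrightarrow> f (v i) (v j) = h (v i) (v j)"
  shows "f x y = h x y"
  by (rule bilinear_eq[OF f h, of UNIV "v ` {1..5}" UNIV "v ` {1..5}"])
    (use assms(3) basis in \<open>auto simp: is_basis_def\<close>)

lemma schouten_like_imp:
  assumes "schouten_like br g" "\<alpha> > 0" "\<gamma> > 0" "\<delta> > 0"
  shows "\<beta> = 0" "\<alpha>\<^sup>2 = 3 / 4 * \<gamma>\<^sup>2" "\<delta>\<^sup>2 = \<alpha>\<^sup>2"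
proof -
  obtain c D where D: "derivation br D"
    and ric: "\<And>x y. ricci br g x y = c * g x y + g (D x) y"
    using assms(1) unfolding schouten_like_iff by blast
  have gD: "g (D x) y = ricci br g x y - c * g x y" for x y
    by (simp add: ric)
  have linD: "linear D" and der: "D (br x y) = br (D x) y + br x (D y)" for x y
    using D by (auto simp: derivation_def)
  note D_simps = linear_add[OF linD] linear_cmul[OF linD]
  \<comment> \<open>The coefficients are the rows of the Ricci matrix with \<open>c\<close>
    subtracted on the diagonal.\<close>
  have D1: "D (v 1) = (- (\<alpha>\<^sup>2 + \<beta>\<^sup>2 + \<gamma>\<^sup>2 + \<delta>\<^sup>2) / 2 - c) *\<^sub>R v 1"
    by (rule frame_eqI; simp add: gD ricci_frame g_simps g_frame)
  have D2: "D (v 2) = (- (\<alpha>\<^sup>2 + \<beta>\<^sup>2) / 2 - c) *\<^sub>R v 2 - (\<beta> * \<gamma> / 2) *\<^sub>R v 3"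
    by (rule frame_eqI; simp add: gD ricci_frame g_simps g_frame)
  have D3: "D (v 3) = - (\<beta> * \<gamma> / 2) *\<^sub>R v 2 + ((\<alpha>\<^sup>2 - \<gamma>\<^sup>2) / 2 - c) *\<^sub>R v 3 + (\<alpha> * \<beta> / 2) *\<^sub>R v 4"
    by (rule frame_eqI; simp add: gD ricci_frame g_simps g_frame)
  have D4: "D (v 4) = (\<alpha> * \<beta> / 2) *\<^sub>R v 3 + ((\<beta>\<^sup>2 + \<gamma>\<^sup>2 - \<delta>\<^sup>2) / 2 - c) *\<^sub>R v 4"
    by (rule frame_eqI; simp add: gD ricci_frame g_simps g_frame)
  have D5: "D (v 5) = (\<delta>\<^sup>2 / 2 - c) *\<^sub>R v 5"
    by (rule frame_eqI; simp add: gD ricci_frame g_simps g_frame)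
  note D_frame = D1 D2 D3 D4 D5
  have comp: "g (D (br x y)) z = g (br (D x) y) z + g (br x (D y)) z" for x y z
    by (simp add: der g_simps)
  \<comment> \<open>\<open>D (v 4)\<close> has a \<open>v 3\<close>-part, and its bracket with
    \<open>v 1\<close> is the only contribution along \<open>v 4\<close>.\<close>
  have "\<alpha> * \<beta> * \<gamma> = 0"
    using comp[of "v 1" "v 4" "v 4"] by (simp add: frame_simps D_simps D_frame)
  then show \<beta>: "\<beta> = 0"
    using assms by simp
  \<comment> \<open>The three eigenvalue relations follow, each doubled and still multiplied by its
    positive structure constant.\<close>
  have "\<alpha> * (\<alpha>\<^sup>2 - \<gamma>\<^sup>2 - 2 * c) = \<alpha> * (- (\<alpha>\<^sup>2 + \<gamma>\<^sup>2 + \<delta>\<^sup>2) - 2 * c - \<alpha>\<^sup>2 - 2 * c)"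
    using comp[of "v 1" "v 2" "v 3"] by (simp add: frame_simps D_simps D_frame \<beta> field_simps)
  moreover have "\<gamma> * (\<gamma>\<^sup>2 - \<delta>\<^sup>2 - 2 * c) = \<gamma> * (- (\<alpha>\<^sup>2 + \<gamma>\<^sup>2 + \<delta>\<^sup>2) - 2 * c + \<alpha>\<^sup>2 - \<gamma>\<^sup>2 - 2 * c)"
    using comp[of "v 1" "v 3" "v 4"] by (simp add: frame_simps D_simps D_frame \<beta> field_simps)
  moreover have "\<delta> * (\<delta>\<^sup>2 - 2 * c) = \<delta> * (- (\<alpha>\<^sup>2 + \<gamma>\<^sup>2 + \<delta>\<^sup>2) - 2 * c + \<gamma>\<^sup>2 - \<delta>\<^sup>2 - 2 * c)"
    using comp[of "v 1" "v 4" "v 5"] by (simp add: frame_simps D_simps D_frame \<beta> field_simps)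
  ultimately have
    "\<alpha>\<^sup>2 - \<gamma>\<^sup>2 - 2 * c = - (\<alpha>\<^sup>2 + \<gamma>\<^sup>2 + \<delta>\<^sup>2) - 2 * c - \<alpha>\<^sup>2 - 2 * c"
    "\<gamma>\<^sup>2 - \<delta>\<^sup>2 - 2 * c = - (\<alpha>\<^sup>2 + \<gamma>\<^sup>2 + \<delta>\<^sup>2) - 2 * c + \<alpha>\<^sup>2 - \<gamma>\<^sup>2 - 2 * c"
    "\<delta>\<^sup>2 - 2 * c = - (\<alpha>\<^sup>2 + \<gamma>\<^sup>2 + \<delta>\<^sup>2) - 2 * c + \<gamma>\<^sup>2 - \<delta>\<^sup>2 - 2 * c"
    using assms(2-4) by simp_all
  \<comment> \<open>The relations simplify to \<open>- 2 * c = 3 * \<alpha>\<^sup>2 +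
    \<delta>\<^sup>2 = 3 * \<gamma>\<^sup>2 = \<alpha>\<^sup>2 + 3 * \<delta>\<^sup>2\<close>, which
    is linear in the squares.\<close>
  then show "\<alpha>\<^sup>2 = 3 / 4 * \<gamma>\<^sup>2" "\<delta>\<^sup>2 = \<alpha>\<^sup>2"
    by linarith+
qed

text \<open>The hypotheses are oriented as rewrite rules that turn every diagonal Ricci entry into a
  multiple of \<open>\<alpha>\<^sup>2\<close>.\<close>

lemma schouten_like_converse:
  assumes \<beta>: "\<beta> = 0" and \<gamma>: "\<gamma>\<^sup>2 = 4 / 3 * \<alpha>\<^sup>2" and \<delta>: "\<delta>\<^sup>2 = \<alpha>\<^sup>2"
  shows "schouten_like br g"
proof -
  \<comment> \<open>The eigenvalues are those of \<open>Ric + 2 \<alpha>\<^sup>2\<close>, the constant being forced by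
    \<open>2 \<alpha>\<^sup>2 - \<gamma>\<^sup>2 = 2 d1\<close>.\<close>
  define D where "D x = \<alpha>\<^sup>2 *\<^sub>R ((g x (v 1) / 3) *\<^sub>R v 1 + (g x (v 2) * 3 / 2) *\<^sub>R v 2
    + (g x (v 3) * 11 / 6) *\<^sub>R v 3 + (g x (v 4) * 13 / 6) *\<^sub>R v 4 + (g x (v 5) * 5 / 2) *\<^sub>R v 5)" for x
  have linD: "linear D"
    by (intro linearI) (simp_all add: D_def g_simps algebra_simps add_divide_distrib)
  note D_simps = linear_add[OF linD] linear_cmul[OF linD] linear_0[OF linD] linear_neg[OF linD]
  have D_frame: "D (v 1) = (\<alpha>\<^sup>2 / 3) *\<^sub>R v 1" "D (v 2) = (3 / 2 * \<alpha>\<^sup>2) *\<^sub>R v 2"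
    "D (v 3) = (11 / 6 * \<alpha>\<^sup>2) *\<^sub>R v 3" "D (v 4) = (13 / 6 * \<alpha>\<^sup>2) *\<^sub>R v 4"
    "D (v 5) = (5 / 2 * \<alpha>\<^sup>2) *\<^sub>R v 5"
    by (simp_all add: D_def g_frame)
  have "D (br x y) = br (D x) y + br x (D y)" for x y
  proof (rule bilinear_eq_on_frame[of "\<lambda>x y. D (br x y)" "\<lambda>x y. br (D x) y + br x (D y)"])
    show "bilinear (\<lambda>x y. D (br x y))" "bilinear (\<lambda>x y. br (D x) y + br x (D y))"
      unfolding bilinear_def
      by (intro conjI allI linearI; simp add: D_simps br_simps algebra_simps)+
    fix i j :: nat assume "i \<in> {1..5}" "j \<in> {1..5}"
    \<comment> \<open>Up to antisymmetry only the brackets of \<open>v 1\<close> with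
      \<open>v 2\<close>, \<open>v 3\<close>, \<open>v 4\<close> are nonzero. There the identity
      amounts to 11/6 = 1/3 + 3/2, 13/6 = 1/3 + 11/6 and 5/2 = 1/3 + 13/6.\<close>
    then show "D (br (v i) (v j)) = br (D (v i)) (v j) + br (v i) (D (v j))"
      by (elim frame_index_cases)
        (simp_all add: D_simps frame_simps D_frame \<beta> flip: scaleR_add_left,
         simp_all add: algebra_simps flip: scaleR_add_left)
  qed
  then have "derivation br D"
    using linD by (simp add: derivation_def)
  moreover have "g (D x) y = g x (D y)" for x y
    by (simp add: D_def g_simps g_sym[of _ y] algebra_simps)
  moreover have "ricci br g x y = (- 2 * \<alpha>\<^sup>2) * g x y + g (D x) y" for x y
  proof (rule bilinear_eq_on_frame[OF bilinear_ricci, of "\<lambda>x y. (- 2 * \<alpha>\<^sup>2) * g x y + g (D x) y"])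
    show "bilinear (\<lambda>x y. (- 2 * \<alpha>\<^sup>2) * g x y + g (D x) y)"
      unfolding bilinear_def
      by (intro conjI allI linearI) (simp_all add: D_simps g_simps algebra_simps)
    fix i j :: nat assume "i \<in> {1..5}" "j \<in> {1..5}"
    then show "ricci br g (v i) (v j) = (- 2 * \<alpha>\<^sup>2) * g (v i) (v j) + g (D (v i)) (v j)"
      by (elim frame_index_cases) (simp_all add: ricci_frame frame_simps D_frame \<beta> \<gamma> \<delta>)
  qed
  ultimately show ?thesis
    unfolding schouten_like_iff by blast
qed

lemma schouten_like_characterization:
  assumes "\<alpha> > 0" "\<gamma> > 0" "\<delta> > 0"
  shows "schouten_like br g \<longleftrightarrow> \<beta> = 0 \<and> \<alpha> = sqrt 3 / 2 * \<gamma> \<and> \<delta> = sqrt 3 / 2 * \<gamma>"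
proof -
  \<comment> \<open>Both sides are nonnegative, so squaring loses nothing and the root
    disappears.\<close>
  have sq: "a = sqrt 3 / 2 * \<gamma> \<longleftrightarrow> a\<^sup>2 = 3 / 4 * \<gamma>\<^sup>2" if "a > 0" for a
  proof -
    have "a = sqrt 3 / 2 * \<gamma> \<longleftrightarrow> a\<^sup>2 = (sqrt 3 / 2 * \<gamma>)\<^sup>2"
      using that assms by (intro power2_eq_iff_nonneg[symmetric]) auto
    then show ?thesis
      by (simp add: power_mult_distrib power_divide)
  qed
  have \<gamma>_iff: "\<gamma>\<^sup>2 = 4 / 3 * \<alpha>\<^sup>2 \<longleftrightarrow> \<alpha>\<^sup>2 = 3 / 4 * \<gamma>\<^sup>2"
    by auto
  show ?thesis
    unfolding sq[OF assms(1)] sq[OF assms(3)]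
    using schouten_like_imp[OF _ assms] schouten_like_converse by (metis \<gamma>_iff)
qed

end

theorem proposition11:
  fixes br :: "'g::real_vector \<Rightarrow> 'g \<Rightarrow> 'g"
    and ip :: "'g \<Rightarrow> 'g \<Rightarrow> real"
    and v :: "nat \<Rightarrow> 'g"
    and \<eta> \<alpha> \<beta> \<gamma> \<delta> :: real
  assumes "is_A52 br"
    and "inner_product ip"
    and "\<eta> > 0"
    and "is_basis 5 v"
    and "\<And>i j. i \<in> {1..5} \<Longrightarrow> j \<in> {1..5} \<Longrightarrow> \<eta> * ip (v i) (v j) = (if i = j then 1 else 0)"
    and "A52_brackets br v \<alpha> \<beta> \<gamma> \<delta>"
    and "\<alpha> > 0" and "\<gamma> > 0" and "\<delta> > 0"
  shows "schouten_like br ip \<longleftrightarrow> \<beta> = 0 \<and> \<alpha> = sqrt 3 / 2 * \<gamma> \<and> \<delta> = sqrt 3 / 2 * \<gamma>"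
proof -
  have lie: "lie_algebra br" and br: "bilinear br" and ip: "bilinear ip"
    using assms(1,2) by (auto simp: is_A52_def lie_algebra_def inner_product_def)
  have "inner_product (\<lambda>x y. \<eta> * ip x y)"
    using assms(2,3) by (auto simp: inner_product_def intro!: bilinear_scale)
  then interpret A52_frame br "\<lambda>x y. \<eta> * ip x y" v \<alpha> \<beta> \<gamma> \<delta>
    using lie assms(4-6) by unfold_locales
  show ?thesis
    \<comment> \<open>The characterization concerns the rescaled metric; scale invariance carries it
      to \<open>ip\<close> with the same structure constants.\<close>
    using schouten_like_characterization[OF assms(7-9)] schouten_like_scale[OF _ br ip, of \<eta>] assms(3)
    by simp
qed

end
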